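(* Let $\kappa\in(0,\infty)$ and $\rho\in\mathcal{P}(\Omega)$. Then the problem $$\inf\Big\{J_{\rho,\kappa}(\nu):=\int_\Omega\mathrm{HK}_\kappa^2(\delta_x,\nu)\,d\rho(x)\;\Big|\;\nu\in\mathcal{M}_+(\Omega)\Big\}$$ admits a minimizer $\nu\in\mathcal{M}_+(\Omega)$, and the objective takes the form $$J_{\rho,\kappa}(\nu)=1+\|\nu\|-2\int_\Omega\sqrt{\int_\Omega\mathrm{Cos}^2(|x-y|/\kappa)\,d\nu(y)}\,d\rho(x).$$
   Context: $\Omega \subset \mathbb{R}^d$ is a compact convex set with non-empty interior. $\mathcal{M}_+(\Omega)$ and $\mathcal{P}(\Omega)$ denote the non-negative Radon measures and probability measures on $\Omega$, and $\|\mu\| = \mu(\Omega)$. $\mathrm{Cos}(s):=\cos(\min\{|s|,\pi/2\})$. For $\kappa\in(0,\infty)$ and $\mu,\nu\in\mathcal{M}_+(\Omega)$ the Hellinger--Kantorovich distance is $$\mathrm{HK}_\kappa^2(\mu,\nu) := \inf_{\gamma\in\mathcal{M}_+(\Omega\times\Omega)} \int \hat c_\kappa\,d\gamma + \mathrm{KL}(P_1\gamma|\mu)+\mathrm{KL}(P_2\gamma|\nu),$$ where $P_1\gamma,P_2\gamma$ are the two marginals of $\gamma$, $\hat c_\kappa(x,y) = -2\log\cos(|x-y|/\kappa)$ if $|x-y|\le\kappa\pi/2$ (with $-\log 0=+\infty$) and $+\infty$ otherwise, and $\mathrm{KL}(\mu|\nu)=\int\varphi(d\mu/d\nu)\,d\nu$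 if $\mu\ll\nu$, $\mu\ge0$, and $+\infty$ otherwise, with $\varphi(s)=s\log s-s+1$ for $s>0$, $\varphi(0)=1$. *)

theory Defs
  imports "HOL-Probability.Probability"
begin

text \<open>
  On a compact \<open>S\<close> in a Euclidean space every finite Borel measure is regular, so the non-negative
  Radon measures on \<open>S\<close> are exactly the finite measures on the Borel sets of \<open>S\<close>.
\<close>

definition radon_measures :: "'b::topological_space set \<Rightarrow> 'b measure set" where
  "radon_measures S = {\<mu>. sets \<mu> = sets (restrict_space borel S) \<and> finite_measure \<mu>}"

definition prob_measures :: "'b::topological_space set \<Rightarrow> 'b measure set" where
  "prob_measures S = {\<mu> \<in> radon_measures S. prob_space \<mu>}"

abbreviation dirac :: "'b::topological_space set \<Rightarrow> 'b \<Rightarrow> 'b measure" where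
  "dirac S x \<equiv> return (restrict_space borel S) x"

abbreviation marginal1 :: "'b::topological_space set \<Rightarrow> ('b \<times> 'b) measure \<Rightarrow> 'b measure" where
  "marginal1 S \<gamma> \<equiv> distr \<gamma> (restrict_space borel S) fst"

abbreviation marginal2 :: "'b::topological_space set \<Rightarrow> ('b \<times> 'b) measure \<Rightarrow> 'b measure" where
  "marginal2 S \<gamma> \<equiv> distr \<gamma> (restrict_space borel S) snd"

definition KL_phi :: "real \<Rightarrow> real" where
  "KL_phi s = (if s = 0 then 1 else s * ln s - s + 1)"

text \<open>
  \<^const>\<open>KL_phi\<close> is non-negative on \<open>[0,\<infinity>)\<close>, so the cast to \<^typ>\<open>ennreal\<close> does not truncate.
  Note the argument order of \<^const>\<open>RN_deriv\<close> and \<^const>\<open>absolutely_continuous\<close>: the reference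
  measure \<open>\<nu>\<close> comes first.
\<close>

definition KL :: "'b measure \<Rightarrow> 'b measure \<Rightarrow> ennreal" where
  "KL \<mu> \<nu> =
     (if absolutely_continuous \<nu> \<mu>
      then \<integral>\<^sup>+x. ennreal (KL_phi (enn2real (RN_deriv \<nu> \<mu> x))) \<partial>\<nu>
      else \<infinity>)"

text \<open>\<open>- log\<close> on \<open>[0,1]\<close> with \<open>- log 0 = \<infinity>\<close>; the library has \<open>ln 0 = 0\<close> on the reals.\<close>

definition neg_log :: "real \<Rightarrow> ennreal" where
  "neg_log r = (if r = 0 then \<infinity> else ennreal (- ln r))"

definition HK_cost :: "real \<Rightarrow> 'a::euclidean_space \<Rightarrow> 'a \<Rightarrow> ennreal" where
  "HK_cost \<kappa> x y =
     (if norm (x - y) \<le> \<kappa> * pi / 2 then 2 * neg_log (cos (norm (x - y) / \<kappa>)) else \<infinity>)"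

text \<open>The squared Hellinger--Kantorovich distance.\<close>

definition HK_sq :: "'a::euclidean_space set \<Rightarrow> real \<Rightarrow> 'a measure \<Rightarrow> 'a measure \<Rightarrow> ennreal" where
  "HK_sq \<Omega> \<kappa> \<mu> \<nu> =
     (INF \<gamma> \<in> radon_measures (\<Omega> \<times> \<Omega>).
        (\<integral>\<^sup>+(x, y). HK_cost \<kappa> x y \<partial>\<gamma>) + KL (marginal1 \<Omega> \<gamma>) \<mu> + KL (marginal2 \<Omega> \<gamma>) \<nu>)"

definition Cos :: "real \<Rightarrow> real" where
  "Cos s = cos (min \<bar>s\<bar> (pi / 2))"

definition HK_objective :: "'a::euclidean_space set \<Rightarrow> 'a measure \<Rightarrow> real \<Rightarrow> 'a measure \<Rightarrow> ennreal" where
  "HK_objective \<Omega> \<rho> \<kappa> \<nu> = (\<integral>\<^sup>+x. HK_sq \<Omega> \<kappa> (dirac \<Omega> x) \<nu> \<partial>\<rho>)"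

end

theory Submission imports Defs begin

text \<open>
  Write \<open>K x y = Cos\<^sup>2 (|x - y| / \<kappa>)\<close>, so that the cost is \<open>- log K\<close>. A plan with finite energy between
  \<open>\<delta>\<^sub>x\<close> and \<open>\<nu>\<close> lives on \<open>{x} \<times> \<Omega>\<close> and is determined by its second marginal \<open>f \<nu>\<close>. Fenchel--Young
  duality for \<^const>\<open>KL_phi\<close> bounds its energy below by \<open>1 + \<parallel>\<nu>\<parallel> - 2 \<surd>A\<close>, where \<open>A = \<integral> K x y d\<nu>(y)\<close>,
  and \<open>f = K x / \<surd>A\<close> attains the bound. Integrating over \<open>x\<close> gives the formula for \<open>J\<close>.

  For \<open>\<nu> = m Q\<close> with a probability measure \<open>Q\<close> it reads \<open>J(\<nu>) = 1 + m - 2 \<surd>m G(Q)\<close>, which is minimal at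
  \<open>\<surd>m = G(Q)\<close> with value \<open>1 - G(Q)\<^sup>2\<close>; so it suffices to maximize the weakly continuous functional \<open>G\<close>
  over the probability measures on \<open>\<Omega>\<close>. Their weak compactness is reduced to Helly's selection theorem on
  the real line: there are a bounded Borel map \<open>s : \<Omega> \<rightarrow> \<real>\<close> and a continuous map \<open>p : \<real> \<rightarrow> \<Omega>\<close> with
  \<open>p \<circ> s = id\<close>, so limits may be taken for the images under \<open>s\<close> and then transported back by \<open>p\<close>.
\<close>

section \<open>Transport to a Dirac mass\<close>

lemma space_eq_if_sets_restrict_borel:
  "sets M = sets (restrict_space borel S) \<Longrightarrow> space M = S"
  by (drule sets_eq_imp_space_eq) (simp add: space_restrict_space)

section \<open>The cosine kernel and the transport cost\<close>

definition HK_kernel :: "real \<Rightarrow> 'a::euclidean_space \<Rightarrow> 'a \<Rightarrow> real" where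
  "HK_kernel \<kappa> x y = (Cos (norm (x - y) / \<kappa>))\<^sup>2"

lemma HK_kernel_nonneg: "0 \<le> HK_kernel \<kappa> x y"
  by (simp add: HK_kernel_def)

lemma HK_kernel_le_1: "HK_kernel \<kappa> x y \<le> 1"
  unfolding HK_kernel_def Cos_def by (simp add: abs_square_le_1)

lemma continuous_on_HK_kernel:
  fixes A :: "'b::t2_space set"
  assumes "continuous_on A f" "continuous_on A g"
  shows "continuous_on A (\<lambda>z. HK_kernel \<kappa> (f z) (g z))"
  unfolding HK_kernel_def Cos_def divide_inverse
  by (intro continuous_intros assms)

lemma borel_measurable_HK_kernel [measurable]:
  "(\<lambda>z. HK_kernel \<kappa> (fst z) (snd z)) \<in> borel_measurable (borel \<Otimes>\<^sub>M borel)"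
  unfolding borel_prod by (intro borel_measurable_continuous_onI continuous_on_HK_kernel continuous_intros)

text \<open>The factor 2 of the cost becomes the square in the kernel. Since \<open>Cos\<close>
  vanishes from \<pi>/2 on, the kernel is zero exactly where the cost is infinite.\<close>

lemma HK_cost_eq_neg_log_kernel:
  assumes "\<kappa> > 0"
  shows "HK_cost \<kappa> x y = neg_log (HK_kernel \<kappa> x y)"
proof (cases "norm (x - y) \<le> \<kappa> * pi / 2")
  case True
  define r where "r = norm (x - y) / \<kappa>"
  have r: "0 \<le> r" "r \<le> pi / 2"
    using True assms by (auto simp: r_def field_simps)
  then have "Cos r = cos r" by (simp add: Cos_def min_def)
  have c: "HK_cost \<kappa> x y = 2 * neg_log (cos r)" "HK_kernel \<kappa> x y = (cos r)\<^sup>2"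
    using True \<open>Cos r = cos r\<close> by (simp_all add: HK_cost_def HK_kernel_def r_def)
  have "cos r \<ge> 0" using r by (intro cos_ge_zero) auto
  show ?thesis
  proof (cases "cos r = 0")
    case True
    then show ?thesis unfolding c by (simp add: neg_log_def ennreal_mult_top)
  next
    case False
    have "2 * ennreal (- ln (cos r)) = ennreal (2 * - ln (cos r))"
      by (subst ennreal_mult') auto
    then show ?thesis unfolding c using False \<open>cos r \<ge> 0\<close> by (simp add: neg_log_def ln_realpow)
  qed
next
  case False
  then have "norm (x - y) / \<kappa> > pi / 2" using assms by (simp add: field_simps)
  then have "Cos (norm (x - y) / \<kappa>) = 0"
    using assms by (simp add: Cos_def min_absorb2)
  then show ?thesis using False by (simp add: HK_cost_def HK_kernel_def neg_log_def)
qed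

lemma borel_measurable_neg_log [measurable]: "neg_log \<in> borel_measurable borel"
  unfolding neg_log_def by measurable

section \<open>The entropy function and the divergence \<open>KL\<close>\<close>

lemma borel_measurable_KL_phi [measurable]: "KL_phi \<in> borel_measurable borel"
  unfolding KL_phi_def by measurable

text \<open>The convex conjugate of \<open>KL_phi\<close> is \<open>exp t - 1\<close>. For positive
  \<open>s\<close> the inequality is \<open>1 + u \<le> exp u\<close> at
  \<open>u = t - ln s\<close>, multiplied by \<open>s\<close>.\<close>

lemma KL_phi_young:
  assumes "s \<ge> 0"
  shows "s * t \<le> KL_phi s + exp t - 1"
proof (cases "s = 0")
  case False
  with assms have "s > 0" by simp
  have "s * (1 + (t - ln s)) \<le> s * exp (t - ln s)"
    using assms exp_ge_add_one_self by (intro mult_left_mono)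
  also have "\<dots> = exp t" using \<open>s > 0\<close> by (simp add: exp_diff)
  finally show ?thesis using False by (simp add: KL_phi_def algebra_simps)
qed (simp add: KL_phi_def)

lemma KL_phi_nonneg: "s \<ge> 0 \<Longrightarrow> 0 \<le> KL_phi s"
  using KL_phi_young[of s 0] by simp

text \<open>\<open>RN_deriv\<close> is determined only up to null sets, so \<open>KL\<close> can be
  computed from any non-negative real version of the density.\<close>

lemma KL_density:
  assumes "sigma_finite_measure \<nu>" and [measurable]: "f \<in> borel_measurable \<nu>" and "\<And>x. f x \<ge> 0"
  shows "KL (density \<nu> (\<lambda>x. ennreal (f x))) \<nu> = (\<integral>\<^sup>+x. ennreal (KL_phi (f x)) \<partial>\<nu>)"
proof -
  interpret sigma_finite_measure \<nu> by fact
  let ?\<mu> = "density \<nu> (\<lambda>x. ennreal (f x))"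
  have "AE x in \<nu>. ennreal (f x) = RN_deriv \<nu> ?\<mu> x"
    by (rule RN_deriv_unique) auto
  then have "AE x in \<nu>. enn2real (RN_deriv \<nu> ?\<mu> x) = f x"
    by eventually_elim (metis assms(3) enn2real_ennreal)
  then have "(\<integral>\<^sup>+x. ennreal (KL_phi (enn2real (RN_deriv \<nu> ?\<mu> x))) \<partial>\<nu>) = (\<integral>\<^sup>+x. ennreal (KL_phi (f x)) \<partial>\<nu>)"
    by (intro nn_integral_cong_AE) (auto elim: eventually_mono)
  moreover have "absolutely_continuous \<nu> ?\<mu>"
    by (rule absolutely_continuousI_density) simp
  ultimately show ?thesis by (simp add: KL_def)
qed

text \<open>Sigma-finiteness of \<mu> makes the derivative finite almost everywhere, so passing
  through \<open>enn2real\<close> changes it only on a null set.\<close>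

lemma ex_real_density:
  assumes "sigma_finite_measure \<nu>" "sigma_finite_measure \<mu>" "absolutely_continuous \<nu> \<mu>" "sets \<mu> = sets \<nu>"
  obtains f :: "'a \<Rightarrow> real" where "f \<in> borel_measurable \<nu>" "\<And>x. f x \<ge> 0"
    "\<mu> = density \<nu> (\<lambda>x. ennreal (f x))"
proof
  interpret sigma_finite_measure \<nu> by fact
  let ?f = "\<lambda>x. enn2real (RN_deriv \<nu> \<mu> x)"
  show "?f \<in> borel_measurable \<nu>" by measurable
  have "AE x in \<nu>. RN_deriv \<nu> \<mu> x \<noteq> \<infinity>" by (rule RN_deriv_finite) fact+
  then have "AE x in \<nu>. RN_deriv \<nu> \<mu> x = ennreal (?f x)"
    by eventually_elim (simp add: ennreal_enn2real_if)
  then have "density \<nu> (RN_deriv \<nu> \<mu>) = density \<nu> (\<lambda>x. ennreal (?f x))"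
    by (intro density_cong) auto
  then show "\<mu> = density \<nu> (\<lambda>x. ennreal (?f x))"
    using density_RN_deriv[OF assms(3,4)] by simp
qed auto

text \<open>Absolute continuity with respect to a point mass means that no mass lies off
  \<open>x\<close>. The density is then seen only at \<open>x\<close>, where it equals the total
  mass.\<close>

lemma KL_return:
  assumes "finite_measure \<mu>" "sets \<mu> = sets M" "x \<in> space M" "{x} \<in> sets M"
  shows "KL \<mu> (return M x) =
    (if emeasure \<mu> (space M - {x}) = 0 then ennreal (KL_phi (measure \<mu> (space M))) else \<infinity>)"
proof -
  interpret D: prob_space "return M x" using assms(3) by (rule prob_space_return)
  interpret \<mu>: finite_measure \<mu> by fact
  have sp: "space \<mu> = space M" using assms(2) by (rule sets_eq_imp_space_eq)
  have co: "space M - {x} \<in> sets M" using assms(4) by auto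
  have ac: "absolutely_continuous (return M x) \<mu> \<longleftrightarrow> emeasure \<mu> (space M - {x}) = 0"
  proof
    assume "absolutely_continuous (return M x) \<mu>"
    then show "emeasure \<mu> (space M - {x}) = 0"
      by (rule absolutely_continuousD) (use co in auto)
  next
    assume 0: "emeasure \<mu> (space M - {x}) = 0"
    show "absolutely_continuous (return M x) \<mu>"
      unfolding absolutely_continuous_def
    proof
      fix A assume "A \<in> null_sets (return M x)"
      then have A: "A \<in> sets M" "x \<notin> A" by (auto simp: null_sets_def indicator_def)
      then have "A \<subseteq> space M - {x}" using sets.sets_into_space by auto
      then have "emeasure \<mu> A \<le> emeasure \<mu> (space M - {x})"
        using co assms(2) by (intro emeasure_mono) auto
      then show "A \<in> null_sets \<mu>" using 0 A assms(2) by (simp add: null_sets_def)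
    qed
  qed
  show ?thesis
  proof (cases "absolutely_continuous (return M x) \<mu>")
    case True
    obtain f where f: "f \<in> borel_measurable (return M x)" "\<And>x. f x \<ge> 0"
      and \<mu>: "\<mu> = density (return M x) (\<lambda>x. ennreal (f x))"
      using ex_real_density[OF D.sigma_finite_measure \<mu>.sigma_finite_measure True] assms(2) by auto
    have [measurable]: "f \<in> borel_measurable M" using f(1) by simp
    have "KL \<mu> (return M x) = ennreal (KL_phi (f x))"
      unfolding \<mu> using D.sigma_finite_measure f assms(3)
      by (subst KL_density) (auto simp: nn_integral_return)
    moreover have "emeasure \<mu> (space M) = ennreal (f x)"
    proof -
      have "emeasure \<mu> (space M) = (\<integral>\<^sup>+z. ennreal (f z) \<partial>return M x)"
        unfolding \<mu> using f(1) by (subst emeasure_density) (auto intro!: nn_integral_cong)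
      then show ?thesis using assms(3) by (simp add: nn_integral_return)
    qed
    ultimately show ?thesis using True ac f(2) by (simp add: measure_def)
  qed (use ac in \<open>simp add: KL_def\<close>)
qed

section \<open>Duality and optimal densities for a one-point source\<close>

text \<open>Young's inequality with both sides moved according to the sign of \<open>L\<close>, since \<^typ>\<open>ennreal\<close> has no negative values.\<close>

lemma transport_young:
  assumes "f \<ge> 0" "a \<ge> 0" "a \<le> 1"
  shows "ennreal (max 0 L * f) + 1 \<le>
    ennreal f * neg_log a + ennreal (KL_phi f) + ennreal (exp L * a) + ennreal (max 0 (- L) * f)"
proof (cases "a = 0")
  \<comment> \<open>Positive \<open>f\<close> makes the cost infinite; for \<open>f = 0\<close> the
    convention \<open>0 * \<infinity> = 0\<close> leaves \<open>KL_phi 0 = 1\<close>, which covers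
    the 1 on the left.\<close>
  case True
  show ?thesis
  proof (cases "f = 0")
    case False
    then have "ennreal f * neg_log a = \<infinity>"
      using True assms by (simp add: neg_log_def ennreal_mult_top)
    then show ?thesis by simp
  qed (simp add: KL_phi_def)
next
  case False
  with assms have "a > 0" by simp
  \<comment> \<open>The dual variable is \<open>L\<close> minus the cost \<open>- ln a\<close>, so
    that its exponential is \<open>exp L * a\<close>.\<close>
  have "f * (L + ln a) \<le> KL_phi f + exp (L + ln a) - 1"
    using assms(1) by (rule KL_phi_young)
  moreover have "exp (L + ln a) = exp L * a" using \<open>a > 0\<close> by (simp add: exp_add)
  moreover have "f * L = max 0 L * f - max 0 (- L) * f"
    by (auto simp: max_def algebra_simps)
  ultimately have le: "max 0 L * f + 1 \<le> f * - ln a + KL_phi f + exp L * a + max 0 (- L) * f"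
    by (simp add: algebra_simps)
  have "ln a \<le> 0" using \<open>a > 0\<close> assms by simp
  have "ennreal f * neg_log a = ennreal (f * - ln a)"
    using False assms by (simp add: neg_log_def ennreal_mult'[symmetric])
  moreover have "0 \<le> f * - ln a" using assms(1) \<open>ln a \<le> 0\<close> by (intro mult_nonneg_nonneg) auto
  ultimately have "ennreal f * neg_log a + ennreal (KL_phi f) + ennreal (exp L * a) + ennreal (max 0 (- L) * f)
      = ennreal (f * - ln a + KL_phi f + exp L * a + max 0 (- L) * f)"
    using assms KL_phi_nonneg[OF assms(1)] by (simp add: ennreal_plus[symmetric] del: ennreal_plus)
  moreover have "ennreal (max 0 L * f) + 1 = ennreal (max 0 L * f + 1)"
    using assms by (simp add: ennreal_plus)
  ultimately show ?thesis using le by (simp only: ennreal_leI)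
qed

text \<open>Weak duality: \<open>f\<close> is the density of the second marginal, \<open>a\<close>
  the kernel \<open>K x\<close>, and \<open>L\<close> a multiplier for the common mass
  \<open>m\<close> of both marginals. Each \<open>L\<close> yields the lower bound
  \<open>1 + V - exp L * A - exp (- L)\<close>, and optimizing over \<open>L\<close> gives the
  claim.\<close>

lemma transport_to_dirac_bound:
  fixes f a :: "'b \<Rightarrow> real"
  assumes "finite_measure \<nu>"
    and [measurable]: "f \<in> borel_measurable \<nu>" "a \<in> borel_measurable \<nu>"
    and f: "\<And>y. f y \<ge> 0" and a: "\<And>y. 0 \<le> a y" "\<And>y. a y \<le> 1"
    and m: "(\<integral>\<^sup>+y. ennreal (f y) \<partial>\<nu>) = ennreal m" "m \<ge> 0"
  shows "ennreal (1 + measure \<nu> (space \<nu>) - 2 * sqrt (\<integral>y. a y \<partial>\<nu>)) \<le>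
    (\<integral>\<^sup>+y. ennreal (f y) * neg_log (a y) \<partial>\<nu>) + ennreal (KL_phi m) + (\<integral>\<^sup>+y. ennreal (KL_phi (f y)) \<partial>\<nu>)"
    (is "ennreal (1 + ?V - 2 * sqrt ?A) \<le> ?C + ennreal ?\<phi> + ?K")
proof (cases "?C = \<infinity> \<or> ?K = \<infinity>")
  case False
  interpret finite_measure \<nu> by fact
  obtain c where c: "?C = ennreal c" "c \<ge> 0" using False by (cases ?C) auto
  obtain k where k: "?K = ennreal k" "k \<ge> 0" using False by (cases ?K) auto
  have "integrable \<nu> a"
    using a by (intro integrable_const_bound[of _ 1]) auto
  then have A: "(\<integral>\<^sup>+y. ennreal (a y) \<partial>\<nu>) = ennreal ?A"
    using a by (intro nn_integral_eq_integral) auto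
  have "?A \<ge> 0" using a by simp
  have "?\<phi> \<ge> 0" using m(2) by (rule KL_phi_nonneg)
  have dual: "1 + ?V - exp L * ?A - exp (- L) \<le> c + ?\<phi> + k" for L
  proof -
    \<comment> \<open>\<open>L\<close> is split into its positive and negative parts to keep all
      integrands non-negative; \<open>P * m - Q * m\<close> is formed only after the passage to
      reals.\<close>
    define P Q where "P = max 0 L" and "Q = max 0 (- L)"
    have PQ: "P \<ge> 0" "Q \<ge> 0" "L = P - Q" by (auto simp: P_def Q_def)
    have "ennreal (P * m + ?V) = ennreal P * ennreal m + ennreal ?V"
      using PQ m(2) by (simp add: ennreal_plus ennreal_mult)
    also have "\<dots> = (\<integral>\<^sup>+y. ennreal (P * f y) + 1 \<partial>\<nu>)"
      using PQ f m(1) by (simp add: nn_integral_add nn_integral_cmult ennreal_mult emeasure_eq_measure)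
    also have "\<dots> \<le> (\<integral>\<^sup>+y. ennreal (f y) * neg_log (a y)
        + ennreal (KL_phi (f y)) + ennreal (exp L * a y) + ennreal (Q * f y) \<partial>\<nu>)"
      unfolding P_def Q_def using f a by (intro nn_integral_mono transport_young)
    also have "\<dots> = ennreal c + ennreal k + ennreal (exp L) * ennreal ?A + ennreal Q * ennreal m"
      using PQ f a by (simp add: nn_integral_add ennreal_mult nn_integral_cmult A m(1) c(1) k(1))
    also have "\<dots> = ennreal (c + k + exp L * ?A + Q * m)"
      using c(2) k(2) m(2) PQ \<open>?A \<ge> 0\<close> by (simp add: ennreal_plus ennreal_mult)
    finally have "P * m + ?V \<le> c + k + exp L * ?A + Q * m"
      using c(2) k(2) m(2) PQ \<open>?A \<ge> 0\<close> by (subst (asm) ennreal_le_iff) auto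
    \<comment> \<open>Young's inequality for the first marginal, with the opposite multiplier, so
      that the terms in \<open>m * L\<close> cancel.\<close>
    moreover have "m * (- L) \<le> ?\<phi> + exp (- L) - 1" using m(2) by (rule KL_phi_young)
    moreover have "m * L = P * m - Q * m" by (simp add: PQ algebra_simps)
    ultimately show ?thesis by (simp add: algebra_simps)
  qed
  have "1 + ?V - 2 * sqrt ?A \<le> c + ?\<phi> + k"
  proof (cases "?A = 0")
    \<comment> \<open>For \<open>A = 0\<close> no finite \<open>L\<close> is optimal:
      \<open>L = - ln e\<close> leaves the error \<open>exp (- L) = e\<close>, which is sent to
      zero.\<close>
    case True
    have "1 + ?V \<le> c + ?\<phi> + k + e" if "e > 0" for e
      using dual[of "- ln e"] True that by simp
    then show ?thesis using True by (simp add: field_le_epsilon)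
  next
    case False
    then have "?A > 0" using \<open>?A \<ge> 0\<close> by simp
    \<comment> \<open>The bound is best at \<open>exp L = 1 / sqrt A\<close>, where both exponential
      terms equal \<open>sqrt A\<close>.\<close>
    then have s: "exp (ln (sqrt ?A)) = sqrt ?A" by simp
    have "exp (- ln (sqrt ?A)) * ?A = sqrt ?A"
      unfolding exp_minus s using \<open>?A > 0\<close> by (simp add: field_simps)
    then show ?thesis using dual[of "- ln (sqrt ?A)"] s by simp
  qed
  then show ?thesis
    unfolding c k using c k \<open>?\<phi> \<ge> 0\<close>
    by (simp add: ennreal_plus[symmetric] ennreal_leI del: ennreal_plus)
qed auto

text \<open>If \<open>A = 0\<close>, then \<open>f = 0\<close> because \<open>x / 0 = 0\<close>: all mass is destroyed and created, at cost \<open>1 + \<parallel>\<nu>\<parallel>\<close>.\<close>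

lemma transport_to_dirac_attained:
  fixes a :: "'b \<Rightarrow> real"
  assumes "finite_measure \<nu>" and [measurable]: "a \<in> borel_measurable \<nu>"
    and a: "\<And>y. 0 \<le> a y" "\<And>y. a y \<le> 1"
  defines "A \<equiv> \<integral>y. a y \<partial>\<nu>"
  defines "f \<equiv> \<lambda>y. a y / sqrt A"
  shows "(\<integral>\<^sup>+y. ennreal (f y) \<partial>\<nu>) = ennreal (sqrt A)"
    and "(\<integral>\<^sup>+y. ennreal (f y) * neg_log (a y) \<partial>\<nu>) + ennreal (KL_phi (sqrt A)) + (\<integral>\<^sup>+y. ennreal (KL_phi (f y)) \<partial>\<nu>)
      = ennreal (1 + measure \<nu> (space \<nu>) - 2 * sqrt A)"
proof -
  interpret finite_measure \<nu> by fact
  have [measurable]: "f \<in> borel_measurable \<nu>" unfolding f_def by measurable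
  have "A \<ge> 0" using a by (simp add: A_def)
  have f: "f y \<ge> 0" for y using a \<open>A \<ge> 0\<close> by (simp add: f_def)
  have inta: "integrable \<nu> a"
    using a by (intro integrable_const_bound[of _ 1]) auto
  then have intf: "integrable \<nu> f" unfolding f_def by simp
  have If: "(\<integral>y. f y \<partial>\<nu>) = sqrt A"
    using \<open>A \<ge> 0\<close> by (simp add: f_def A_def[symmetric] real_div_sqrt)
  show "(\<integral>\<^sup>+y. ennreal (f y) \<partial>\<nu>) = ennreal (sqrt A)"
    unfolding If[symmetric] using intf f by (intro nn_integral_eq_integral) auto
  show "(\<integral>\<^sup>+y. ennreal (f y) * neg_log (a y) \<partial>\<nu>) + ennreal (KL_phi (sqrt A)) + (\<integral>\<^sup>+y. ennreal (KL_phi (f y)) \<partial>\<nu>)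
      = ennreal (1 + measure \<nu> (space \<nu>) - 2 * sqrt A)"
  proof (cases "A = 0")
    case True
    then show ?thesis by (simp add: f_def KL_phi_def emeasure_eq_measure add.commute ennreal_plus)
  next
    case False
    then have "A > 0" using \<open>A \<ge> 0\<close> by simp
    \<comment> \<open>Where \<open>a\<close> is positive, \<open>ln a = ln f + ln (sqrt A)\<close>,
      so the terms \<open>f * ln f\<close> of cost and entropy cancel and an expression affine in
      \<open>f\<close> remains. It is also correct where \<open>a = 0\<close>, because
      \<open>f = 0\<close> there.\<close>
    define g where "g y = f y * - ln (sqrt A) - f y + 1" for y
    have pw: "ennreal (f y) * neg_log (a y) + ennreal (KL_phi (f y)) = ennreal (g y) \<and> 0 \<le> g y" for y
    proof (cases "a y = 0")
      case False
      then have "a y > 0" using a(1)[of y] by simp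
      then have "f y > 0" using \<open>A > 0\<close> by (simp add: f_def)
      have "ln (a y) = ln (f y) + ln (sqrt A)"
        unfolding f_def using \<open>A > 0\<close> \<open>a y > 0\<close> by (simp add: ln_div)
      then have g: "g y = f y * - ln (a y) + KL_phi (f y)"
        using \<open>f y > 0\<close> by (simp add: g_def KL_phi_def ring_distribs)
      have "0 \<le> f y * - ln (a y)"
        using f a(2)[of y] \<open>a y > 0\<close> by (intro mult_nonneg_nonneg) auto
      then have "0 \<le> g y"
        unfolding g using KL_phi_nonneg[OF f] by (intro add_nonneg_nonneg)
      moreover have "ennreal (f y) * neg_log (a y) + ennreal (KL_phi (f y)) = ennreal (g y)"
        unfolding g using False f KL_phi_nonneg[OF f] \<open>0 \<le> f y * - ln (a y)\<close>
        by (simp add: neg_log_def ennreal_mult'[symmetric] ennreal_plus[symmetric] del: ennreal_plus)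
      ultimately show ?thesis by simp
    qed (simp add: f_def g_def KL_phi_def)
    have intg: "integrable \<nu> g" unfolding g_def using intf by simp
    have Ig: "(\<integral>y. g y \<partial>\<nu>) = sqrt A * - ln (sqrt A) - sqrt A + measure \<nu> (space \<nu>)"
      unfolding g_def using intf by (simp add: If)
    have "(\<integral>\<^sup>+y. ennreal (f y) * neg_log (a y) \<partial>\<nu>) + (\<integral>\<^sup>+y. ennreal (KL_phi (f y)) \<partial>\<nu>)
        = (\<integral>\<^sup>+y. ennreal (f y) * neg_log (a y) + ennreal (KL_phi (f y)) \<partial>\<nu>)"
      by (simp add: nn_integral_add)
    also have "\<dots> = ennreal (\<integral>y. g y \<partial>\<nu>)"
      using pw intg by (simp add: nn_integral_eq_integral)
    finally have "(\<integral>\<^sup>+y. ennreal (f y) * neg_log (a y) \<partial>\<nu>) + ennreal (KL_phi (sqrt A)) + (\<integral>\<^sup>+y. ennreal (KL_phi (f y)) \<partial>\<nu>)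
        = ennreal (\<integral>y. g y \<partial>\<nu>) + ennreal (KL_phi (sqrt A))"
      by (simp add: add_ac)
    also have "\<dots> = ennreal ((\<integral>y. g y \<partial>\<nu>) + KL_phi (sqrt A))"
      using pw \<open>A \<ge> 0\<close> by (intro ennreal_plus[symmetric] integral_nonneg KL_phi_nonneg) auto
    also have "(\<integral>y. g y \<partial>\<nu>) + KL_phi (sqrt A) = 1 + measure \<nu> (space \<nu>) - 2 * sqrt A"
      unfolding Ig using \<open>A > 0\<close> by (simp add: KL_phi_def)
    finally show ?thesis .
  qed
qed

section \<open>The squared distance from a Dirac mass\<close>

lemma borel_measurable_HK_kernel_restrict:
  assumes "sets N = sets (restrict_space borel S)"
  shows "HK_kernel \<kappa> x \<in> borel_measurable N"
proof -
  have "HK_kernel \<kappa> x \<in> borel_measurable borel"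
    by (intro borel_measurable_continuous_onI continuous_on_HK_kernel continuous_intros)
  then show ?thesis
    using assms(1) measurable_cong_sets[OF assms(1) refl] measurable_restrict_space1 by blast
qed

lemma HK_sq_dirac:
  assumes "\<kappa> > 0" "x \<in> \<Omega>" and \<nu>: "\<nu> \<in> radon_measures \<Omega>"
  shows "HK_sq \<Omega> \<kappa> (dirac \<Omega> x) \<nu> = ennreal (1 + measure \<nu> \<Omega> - 2 * sqrt (\<integral>y. HK_kernel \<kappa> x y \<partial>\<nu>))"
    (is "_ = ennreal ?r")
proof (rule antisym)
  let ?R = "restrict_space borel \<Omega>" and ?R2 = "restrict_space borel (\<Omega> \<times> \<Omega>) :: ('a \<times> 'a) measure"
  have \<nu>sets: "sets \<nu> = sets ?R" using \<nu> by (simp add: radon_measures_def)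
  have \<nu>space: "space \<nu> = \<Omega>" by (rule space_eq_if_sets_restrict_borel[OF \<nu>sets])
  interpret \<nu>: finite_measure \<nu> using \<nu> by (simp add: radon_measures_def)
  have fst_meas: "fst \<in> measurable ?R2 ?R"
    by (intro measurable_restrict_space2 measurable_restrict_space1)
       (auto simp: space_restrict_space borel_prod[symmetric])
  have snd_meas: "snd \<in> measurable ?R2 ?R"
    by (intro measurable_restrict_space2 measurable_restrict_space1)
       (auto simp: space_restrict_space borel_prod[symmetric])
  have sing: "{x} \<in> sets ?R"
    using \<open>x \<in> \<Omega>\<close> by (auto simp: sets_restrict_space image_iff intro!: bexI[of _ "{x}"])
  have spR [simp]: "space ?R = \<Omega>" "space ?R2 = \<Omega> \<times> \<Omega>" by (simp_all add: space_restrict_space)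
  have KR [measurable]: "HK_kernel \<kappa> x \<in> borel_measurable ?R"
    by (rule borel_measurable_HK_kernel_restrict) simp
  have K\<nu> [measurable]: "HK_kernel \<kappa> x \<in> borel_measurable \<nu>"
    by (rule borel_measurable_HK_kernel_restrict[OF \<nu>sets])
  have K2 [measurable]: "(\<lambda>z. HK_kernel \<kappa> (fst z) (snd z)) \<in> borel_measurable ?R2"
    by (intro measurable_restrict_space1 borel_measurable_continuous_onI continuous_on_HK_kernel continuous_intros)
  note cost = HK_cost_eq_neg_log_kernel[OF \<open>\<kappa> > 0\<close>]
  note Kbd = HK_kernel_nonneg HK_kernel_le_1

  show "ennreal ?r \<le> HK_sq \<Omega> \<kappa> (dirac \<Omega> x) \<nu>"
    unfolding HK_sq_def
  proof (rule INF_greatest)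
    fix \<gamma> :: "('a \<times> 'a) measure" assume "\<gamma> \<in> radon_measures (\<Omega> \<times> \<Omega>)"
    then have \<gamma>sets: "sets \<gamma> = sets ?R2" and "finite_measure \<gamma>" by (auto simp: radon_measures_def)
    interpret \<gamma>: finite_measure \<gamma> by fact
    let ?M = "marginal1 \<Omega> \<gamma>" and ?\<sigma> = "marginal2 \<Omega> \<gamma>"
    have \<gamma>space: "space \<gamma> = \<Omega> \<times> \<Omega>" by (rule space_eq_if_sets_restrict_borel[OF \<gamma>sets])
    have mfst [measurable]: "fst \<in> measurable \<gamma> ?R" using fst_meas measurable_cong_sets[OF \<gamma>sets refl] by blast
    have msnd [measurable]: "snd \<in> measurable \<gamma> ?R" using snd_meas measurable_cong_sets[OF \<gamma>sets refl] by blast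
    have finM: "finite_measure ?M" and fin\<sigma>: "finite_measure ?\<sigma>"
      by (intro \<gamma>.finite_measure_distr mfst msnd)+
    show "ennreal ?r \<le> (\<integral>\<^sup>+(x, y). HK_cost \<kappa> x y \<partial>\<gamma>) + KL ?M (dirac \<Omega> x) + KL ?\<sigma> \<nu>"
    proof (cases "KL ?M (dirac \<Omega> x) = \<infinity> \<or> KL ?\<sigma> \<nu> = \<infinity>")
      case False
      define m where "m = measure ?\<sigma> \<Omega>"
      \<comment> \<open>Both marginals inherit the total mass of \<gamma>, so the same
        \<open>m\<close> enters the first entropy term.\<close>
      have mM: "m = measure ?M \<Omega>"
      proof -
        have "\<Omega> \<in> sets ?R" using sets.top[of ?R] by simp
        moreover have "snd -` \<Omega> \<inter> space \<gamma> = fst -` \<Omega> \<inter> space \<gamma>" using \<gamma>space by auto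
        ultimately show ?thesis unfolding m_def by (simp add: measure_distr)
      qed
      have null: "emeasure ?M (\<Omega> - {x}) = 0" and KL1: "KL ?M (dirac \<Omega> x) = ennreal (KL_phi m)"
        using False KL_return[OF finM, of ?R x] sing \<open>x \<in> \<Omega>\<close> mM by (auto split: if_splits)
      \<comment> \<open>Since the first coordinate is almost everywhere \<open>x\<close>, the cost
        depends on the second one only, and its integral descends to the second marginal.\<close>
      have "AE u in ?M. u = x"
        by (rule AE_I[OF _ null]) (use sets.compl_sets[OF sing] in auto)
      then have AEx: "AE z in \<gamma>. fst z = x" by (rule AE_distrD[OF mfst])
      have "(\<integral>\<^sup>+(x, y). HK_cost \<kappa> x y \<partial>\<gamma>) = (\<integral>\<^sup>+z. neg_log (HK_kernel \<kappa> x (snd z)) \<partial>\<gamma>)"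
        by (rule nn_integral_cong_AE, use AEx in eventually_elim) (auto simp: cost)
      also have "\<dots> = (\<integral>\<^sup>+y. neg_log (HK_kernel \<kappa> x y) \<partial>?\<sigma>)"
        by (subst nn_integral_distr) auto
      finally have C: "(\<integral>\<^sup>+(x, y). HK_cost \<kappa> x y \<partial>\<gamma>) = (\<integral>\<^sup>+y. neg_log (HK_kernel \<kappa> x y) \<partial>?\<sigma>)" .
      have "absolutely_continuous \<nu> ?\<sigma>" using False by (auto simp: KL_def split: if_splits)
      then obtain f where [measurable]: "f \<in> borel_measurable \<nu>" and f: "\<And>y. f y \<ge> 0"
        and \<sigma>: "?\<sigma> = density \<nu> (\<lambda>y. ennreal (f y))"
        using ex_real_density[OF \<nu>.sigma_finite_measure finite_measure.sigma_finite_measure[OF fin\<sigma>]] \<nu>sets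
        by auto
      have "emeasure (density \<nu> (\<lambda>y. ennreal (f y))) (space \<nu>) = (\<integral>\<^sup>+y. ennreal (f y) \<partial>\<nu>)"
        by (subst emeasure_density) (auto intro!: nn_integral_cong)
      then have "(\<integral>\<^sup>+y. ennreal (f y) \<partial>\<nu>) = emeasure ?\<sigma> \<Omega>"
        by (simp only: \<sigma> \<nu>space)
      then have If: "(\<integral>\<^sup>+y. ennreal (f y) \<partial>\<nu>) = ennreal m"
        unfolding m_def by (simp add: finite_measure.emeasure_eq_measure[OF fin\<sigma>])
      have "ennreal ?r \<le> (\<integral>\<^sup>+y. ennreal (f y) * neg_log (HK_kernel \<kappa> x y) \<partial>\<nu>) + ennreal (KL_phi m)
          + (\<integral>\<^sup>+y. ennreal (KL_phi (f y)) \<partial>\<nu>)"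
        unfolding \<nu>space[symmetric] using \<nu>.finite_measure_axioms
        by (intro transport_to_dirac_bound f Kbd If) (auto simp: m_def)
      also have "\<dots> = (\<integral>\<^sup>+(x, y). HK_cost \<kappa> x y \<partial>\<gamma>) + KL ?M (dirac \<Omega> x) + KL ?\<sigma> \<nu>"
        unfolding C KL1 unfolding \<sigma>
        using KL_density[OF \<nu>.sigma_finite_measure, of f] f by (simp add: nn_integral_density)
      finally show ?thesis .
    qed auto
  qed

  define A where "A = (\<integral>y. HK_kernel \<kappa> x y \<partial>\<nu>)"
  define f where "f y = HK_kernel \<kappa> x y / sqrt A" for y
  have [measurable]: "f \<in> borel_measurable \<nu>" unfolding f_def by measurable
  have f: "f y \<ge> 0" for y unfolding f_def A_def by (simp add: HK_kernel_nonneg)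
  have attained: "(\<integral>\<^sup>+y. ennreal (f y) \<partial>\<nu>) = ennreal (sqrt A)"
    "(\<integral>\<^sup>+y. ennreal (f y) * neg_log (HK_kernel \<kappa> x y) \<partial>\<nu>) + ennreal (KL_phi (sqrt A))
      + (\<integral>\<^sup>+y. ennreal (KL_phi (f y)) \<partial>\<nu>) = ennreal ?r"
    unfolding f_def A_def \<nu>space[symmetric]
    by (intro transport_to_dirac_attained \<nu>.finite_measure_axioms K\<nu> Kbd)+
  define \<sigma> where "\<sigma> = density \<nu> (\<lambda>y. ennreal (f y))"
  have \<sigma>sets: "sets \<sigma> = sets ?R" by (simp add: \<sigma>_def \<nu>sets)
  have \<sigma>space: "space \<sigma> = \<Omega>" by (simp add: \<sigma>_def \<nu>space)
  have em\<sigma>: "emeasure \<sigma> \<Omega> = ennreal (sqrt A)"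
    unfolding \<sigma>_def \<nu>space[symmetric] attained(1)[symmetric]
    by (subst emeasure_density) (auto intro!: nn_integral_cong)
  then have "finite_measure \<sigma>" by (intro finite_measureI) (simp add: \<sigma>space)
  interpret \<sigma>: finite_measure \<sigma> by fact
  have Pair_meas [measurable]: "Pair x \<in> measurable \<sigma> ?R2"
  proof -
    have "Pair x \<in> measurable ?R ?R2"
      by (intro measurable_restrict_space2 measurable_restrict_space1)
         (use \<open>x \<in> \<Omega>\<close> in \<open>auto simp: borel_prod[symmetric]\<close>)
    then show ?thesis using measurable_cong_sets[OF \<sigma>sets refl] by blast
  qed
  \<comment> \<open>All mass of this plan starts at \<open>x\<close>: its second marginal is
    \<sigma>, its first is the mass \<open>sqrt A\<close> placed at \<open>x\<close>.\<close>
  define \<gamma> where "\<gamma> = distr \<sigma> ?R2 (Pair x)"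
  have \<gamma>: "\<gamma> \<in> radon_measures (\<Omega> \<times> \<Omega>)"
    unfolding \<gamma>_def radon_measures_def using \<sigma>.finite_measure_distr[OF Pair_meas] by simp
  have M2: "marginal2 \<Omega> \<gamma> = \<sigma>"
    unfolding \<gamma>_def using \<sigma>sets by (subst distr_distr) (auto simp: snd_meas comp_def intro!: distr_id2)
  have M1: "marginal1 \<Omega> \<gamma> = distr \<sigma> ?R (\<lambda>_. x)"
    unfolding \<gamma>_def by (subst distr_distr) (auto simp: fst_meas comp_def)
  have cm: "(\<lambda>_. x) \<in> measurable \<sigma> ?R" using \<open>x \<in> \<Omega>\<close> by simp
  have KL1: "KL (marginal1 \<Omega> \<gamma>) (dirac \<Omega> x) = ennreal (KL_phi (sqrt A))"
  proof -
    have "\<Omega> \<in> sets ?R" using sets.top[of ?R] by simp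
    then have "emeasure (marginal1 \<Omega> \<gamma>) \<Omega> = ennreal (sqrt A)"
      unfolding M1 using em\<sigma> cm \<sigma>space \<open>x \<in> \<Omega>\<close> by (subst emeasure_distr) auto
    moreover have "A \<ge> 0" unfolding A_def by (simp add: HK_kernel_nonneg)
    ultimately have "measure (marginal1 \<Omega> \<gamma>) \<Omega> = sqrt A"
      by (simp add: measure_def)
    moreover have "emeasure (marginal1 \<Omega> \<gamma>) (\<Omega> - {x}) = 0"
      unfolding M1 using sing sets.compl_sets[OF sing] cm by (subst emeasure_distr) auto
    moreover have "finite_measure (marginal1 \<Omega> \<gamma>)" unfolding M1 using cm by (rule \<sigma>.finite_measure_distr)
    ultimately show ?thesis
      using sing \<open>x \<in> \<Omega>\<close> by (subst KL_return) auto
  qed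
  have KL2: "KL (marginal2 \<Omega> \<gamma>) \<nu> = (\<integral>\<^sup>+y. ennreal (KL_phi (f y)) \<partial>\<nu>)"
    unfolding M2 \<sigma>_def using \<nu>.sigma_finite_measure f by (intro KL_density) auto
  have C: "(\<integral>\<^sup>+(x, y). HK_cost \<kappa> x y \<partial>\<gamma>) = (\<integral>\<^sup>+y. ennreal (f y) * neg_log (HK_kernel \<kappa> x y) \<partial>\<nu>)"
  proof -
    have "(\<integral>\<^sup>+(x, y). HK_cost \<kappa> x y \<partial>\<gamma>) = (\<integral>\<^sup>+z. neg_log (HK_kernel \<kappa> (fst z) (snd z)) \<partial>\<gamma>)"
      by (simp only: cost case_prod_unfold)
    also have "\<dots> = (\<integral>\<^sup>+y. neg_log (HK_kernel \<kappa> x y) \<partial>\<sigma>)"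
      unfolding \<gamma>_def by (subst nn_integral_distr) auto
    finally show ?thesis unfolding \<sigma>_def by (simp add: nn_integral_density)
  qed
  show "HK_sq \<Omega> \<kappa> (dirac \<Omega> x) \<nu> \<le> ennreal ?r"
    unfolding HK_sq_def using attained(2) by (intro INF_lower2[OF \<gamma>]) (simp add: C KL1 KL2)
qed

section \<open>Weak sequential compactness\<close>

text \<open>At the first disagreement \<open>k\<close> the digits differ by \<open>(1/3)^k\<close>
  in value, and all later digits together can compensate at most half of that. In base 2 they could
  compensate all of it, hence base 3.\<close>

lemma ternary_expansion_agree:
  fixes b c :: "nat \<Rightarrow> real"
  assumes b: "\<And>n. b n \<in> {0, 1}" and c: "\<And>n. c n \<in> {0, 1}"
    and close: "\<bar>(\<Sum>n. b n * (1/3)^n) - (\<Sum>n. c n * (1/3)^n)\<bar> < (1/3)^N / 2"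
    and "n \<le> N"
  shows "b n = c n"
proof (rule ccontr)
  assume neq: "b n \<noteq> c n"
  define k where "k = (LEAST n. b n \<noteq> c n)"
  have k: "b k \<noteq> c k"
    unfolding k_def using neq by (rule LeastI)
  have less: "\<And>j. j < k \<Longrightarrow> b j = c j"
    unfolding k_def by (blast dest: not_less_Least)
  have "k \<le> n"
    unfolding k_def using neq by (rule Least_le)
  define d where "d n = (b n - c n) * (1/3)^n" for n
  have d_le: "\<bar>d n\<bar> \<le> (1/3)^n" for n
    using b[of n] c[of n] by (auto simp: d_def abs_mult)
  have geo: "summable (\<lambda>n. (1/3::real)^n)"
    by (intro summable_geometric) auto
  have "\<bar>b n * (1/3)^n\<bar> \<le> (1/3)^n" for n
    using b[of n] by auto
  then have sb: "summable (\<lambda>n. b n * (1/3)^n)"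
    by (intro summable_comparison_test'[OF geo, of 0]) simp
  have "\<bar>c n * (1/3)^n\<bar> \<le> (1/3)^n" for n
    using c[of n] by auto
  then have sc: "summable (\<lambda>n. c n * (1/3)^n)"
    by (intro summable_comparison_test'[OF geo, of 0]) simp
  have sd: "summable d"
    unfolding d_def left_diff_distrib by (rule summable_diff[OF sb sc])
  have tail: "(\<lambda>i. (1/3::real)^(i + Suc k)) sums ((1/3)^k / 2)"
    using sums_mult2[OF geometric_sums[of "1/3::real"], of "(1/3)^Suc k"]
    by (simp add: power_add mult.commute)
  have "norm (\<Sum>i. d (i + Suc k)) \<le> (\<Sum>i. (1/3::real)^(i + Suc k))"
    unfolding real_norm_def[symmetric]
    by (intro norm_suminf_le sums_summable[OF tail]) (simp only: real_norm_def d_le)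
  then have t: "\<bar>\<Sum>i. d (i + Suc k)\<bar> \<le> (1/3)^k / 2"
    using sums_unique[OF tail] by simp
  have "(\<Sum>n. b n * (1/3)^n) - (\<Sum>n. c n * (1/3)^n) = suminf d"
    unfolding d_def left_diff_distrib by (rule suminf_diff[OF sb sc])
  also have "\<dots> = (\<Sum>i. d (i + Suc k)) + sum d {..<Suc k}"
    by (rule suminf_split_initial_segment[OF sd])
  also have "sum d {..<Suc k} = d k"
    using less by (simp add: d_def)
  finally have eq: "(\<Sum>n. b n * (1/3)^n) - (\<Sum>n. c n * (1/3)^n) = (\<Sum>i. d (i + Suc k)) + d k" .
  have "\<bar>d k\<bar> = (1/3)^k"
    using b[of k] c[of k] k by (auto simp: d_def abs_mult)
  then have "(1/3)^k / 2 < (1/3::real)^N / 2"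
    using close t unfolding eq by linarith
  moreover have "(1/3::real)^N \<le> (1/3)^k"
    using \<open>k \<le> n\<close> \<open>n \<le> N\<close> by (intro power_decreasing) auto
  ultimately show False by simp
qed

text \<open>The code need not be continuous; what matters is the last property, by which it is
  injective on \<open>S\<close> with uniformly continuous inverse. Finitely many small basic sets
  cover \<open>S\<close>, so agreement of finitely many digits forces two points to be
  close.\<close>

lemma compact_borel_real_code:
  fixes S :: "'a::{metric_space, second_countable_topology} set"
  assumes "compact S"
  obtains s :: "'a \<Rightarrow> real" where "s \<in> borel_measurable borel" "\<And>y. s y \<in> {0..2}"
    "\<And>e. e > 0 \<Longrightarrow> \<exists>d>0. \<forall>x\<in>S. \<forall>y\<in>S. \<bar>s x - s y\<bar> < d \<longrightarrow> dist x y < e"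
proof -
  obtain \<B> :: "'a set set" where \<B>: "countable \<B>" "topological_basis \<B>"
    using ex_countable_basis by blast
  define B where "B = from_nat_into \<B>"
  have "\<B> \<noteq> {}"
    using topological_basisE[OF \<B>(2) open_UNIV, of undefined] by auto
  then have opB: "open (B n)" for n
    unfolding B_def using from_nat_into topological_basis_open[OF \<B>(2)] by blast
  have B: "\<exists>n. x \<in> B n \<and> B n \<subseteq> U" if "open U" "x \<in> U" for U x
    unfolding B_def using topological_basisE[OF \<B>(2) that] from_nat_into_surj[OF \<B>(1)] by metis
  \<comment> \<open>A point is coded by its membership in the sets of a countable basis, read as ternary digits.\<close>
  define s where "s y = (\<Sum>n. indicator (B n) y * (1/3::real)^n)" for y
  have geo: "(\<lambda>n. (1/3::real)^n) sums (3/2)"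
    using geometric_sums[of "1/3::real"] by simp
  have sm: "summable (\<lambda>n. indicator (B n) y * (1/3::real)^n)" for y
    by (rule summable_comparison_test'[OF sums_summable[OF geo], of 0]) (auto simp: indicator_def)
  show thesis
  proof
    have [measurable]: "B n \<in> sets borel" for n using opB by auto
    show "s \<in> borel_measurable borel" unfolding s_def by measurable
    show "s y \<in> {0..2}" for y
    proof -
      have "s y \<le> 3/2"
        unfolding s_def sums_unique[OF geo]
        by (intro suminf_le sm sums_summable[OF geo]) (auto simp: indicator_def)
      moreover have "0 \<le> s y" unfolding s_def by (intro suminf_nonneg sm) auto
      ultimately show ?thesis by simp
    qed
    fix e :: real assume "e > 0"
    define I where "I = {n. \<exists>z. B n \<subseteq> ball z (e/2)}"
    have "S \<subseteq> (\<Union>n\<in>I. B n)"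
    proof
      fix z assume "z \<in> S"
      obtain n where "z \<in> B n" "B n \<subseteq> ball z (e/2)"
        using B[OF open_ball, of z z "e/2"] \<open>e > 0\<close> by auto
      then show "z \<in> (\<Union>n\<in>I. B n)" by (auto simp: I_def)
    qed
    then obtain J where J: "J \<subseteq> I" "finite J" "S \<subseteq> (\<Union>n\<in>J. B n)"
      using compactE_image[OF assms, of I B] opB by metis
    \<comment> \<open>\<open>N\<close> is the last digit deciding membership in a set of the finite
      cover; codes closer than \<open>(1/3)^N / 2\<close> agree on all these digits.\<close>
    define N where "N = Max J"
    have N: "n \<le> N" if "n \<in> J" for n unfolding N_def using J(2) that by (rule Max_ge)
    show "\<exists>d>0. \<forall>x\<in>S. \<forall>y\<in>S. \<bar>s x - s y\<bar> < d \<longrightarrow> dist x y < e"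
    proof (intro exI conjI ballI impI)
      fix x y assume "x \<in> S" "y \<in> S" and close: "\<bar>s x - s y\<bar> < (1/3)^N / 2"
      obtain n where n: "n \<in> J" "x \<in> B n" using \<open>x \<in> S\<close> J(3) by auto
      have "indicator (B n) x = (indicator (B n) y :: real)"
        using close N[OF n(1)] unfolding s_def
        by (intro ternary_expansion_agree[of "\<lambda>n. indicator (B n) x" "\<lambda>n. indicator (B n) y" N n])
           (auto simp: indicator_def)
      then have "y \<in> B n" using n(2) by (auto simp: indicator_def split: if_splits)
      moreover obtain z where "B n \<subseteq> ball z (e/2)" using J(1) n(1) by (auto simp: I_def)
      ultimately have "dist z x < e/2" "dist z y < e/2" using n(2) by auto
      then show "dist x y < e" by (metis dist_commute dist_triangle_half_l)
    qed simp
  qed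
qed

section \<open>A continuous map from the line onto a compact convex set\<close>

text \<open>The inverse of the code extends by uniform continuity to the closure of its domain and
  by Dugundji's theorem to the whole line. The nearest-point projection, continuous because
  \<open>S\<close> is closed and convex, then brings all values into \<open>S\<close> and fixes the
  points of \<open>S\<close>.\<close>

lemma compact_convex_real_parametrization:
  fixes S :: "'a::euclidean_space set"
  assumes "compact S" "convex S" "S \<noteq> {}"
  obtains s :: "'a \<Rightarrow> real" and p :: "real \<Rightarrow> 'a"
  where "s \<in> borel_measurable borel" "\<And>y. s y \<in> {0..2}"
    "continuous_on UNIV p" "\<And>t. p t \<in> S" "\<And>y. y \<in> S \<Longrightarrow> p (s y) = y"
proof -
  obtain s :: "'a \<Rightarrow> real" where s: "s \<in> borel_measurable borel" "\<And>y. s y \<in> {0..2}"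
    and unif: "\<And>e. e > 0 \<Longrightarrow> \<exists>d>0. \<forall>x\<in>S. \<forall>y\<in>S. \<bar>s x - s y\<bar> < d \<longrightarrow> dist x y < e"
    using compact_borel_real_code[OF assms(1)] by metis
  have inj: "inj_on s S"
  proof (rule inj_onI, rule ccontr)
    fix x y assume xy: "x \<in> S" "y \<in> S" "s x = s y" "x \<noteq> y"
    \<comment> \<open>Applied with \<open>e = dist x y\<close>, the estimate would put two distinct
      points of equal code at less than their own distance.\<close>
    then obtain d where "d > 0" "\<bar>s x - s y\<bar> < d \<longrightarrow> dist x y < dist x y"
      using unif[of "dist x y"] by (metis zero_less_dist_iff)
    then show False using xy by simp
  qed
  define q where "q = the_inv_into S s"
  have q: "q (s y) = y" if "y \<in> S" for y
    unfolding q_def by (rule the_inv_into_f_f[OF inj that])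
  have "uniformly_continuous_on (s ` S) q"
    unfolding uniformly_continuous_on_def using unif
    by (auto simp: q dist_real_def abs_minus_commute) (metis dist_commute abs_minus_commute)
  then obtain g where g: "uniformly_continuous_on (closure (s ` S)) g" "\<And>t. t \<in> s ` S \<Longrightarrow> q t = g t"
    by (rule uniformly_continuous_on_extension_on_closure) blast
  have contg: "continuous_on (closure (s ` S)) g"
    using g(1) by (rule uniformly_continuous_imp_continuous)
  obtain h where h: "continuous_on UNIV h" "\<And>t. t \<in> closure (s ` S) \<Longrightarrow> h t = g t"
    using Dugundji[OF convex_UNIV UNIV_not_empty, of UNIV "closure (s ` S)" g] contg by auto
  have "closed S" using assms(1) by (rule compact_imp_closed)
  show thesis
  proof
    show "continuous_on UNIV (closest_point S \<circ> h)"
      using h(1) by (intro continuous_on_compose continuous_on_closest_point assms \<open>closed S\<close>)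
    show "(closest_point S \<circ> h) t \<in> S" for t
      using closest_point_in_set[OF \<open>closed S\<close> assms(3)] by simp
    show "(closest_point S \<circ> h) (s y) = y" if "y \<in> S" for y
      using that h(2)[of "s y"] g(2)[of "s y"] closure_subset[of "s ` S"]
      by (auto simp: q closest_point_self)
  qed (use s in auto)
qed

section \<open>Weak limits of probability measures\<close>

text \<open>A limit \<open>M\<close> of the image measures may charge reals that code no point of
  \<open>S\<close>, so \<open>p\<close> has to be defined and continuous on the whole line. Then
  \<open>f \<circ> p\<close> is a bounded continuous test function, and \<open>p (s y) = y\<close>
  turns its integrals into those of \<open>f\<close>.\<close>

lemma prob_measures_weakly_sequentially_compact:
  fixes S :: "'a::euclidean_space set"
  assumes "compact S" "convex S" "S \<noteq> {}" and Q: "\<And>n::nat. Q n \<in> prob_measures S"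
  obtains r Q' where "strict_mono r" "Q' \<in> prob_measures S"
    "\<And>f :: 'a \<Rightarrow> real. continuous_on S f \<Longrightarrow> (\<lambda>n. \<integral>y. f y \<partial>Q (r n)) \<longlonglongrightarrow> (\<integral>y. f y \<partial>Q')"
proof -
  let ?R = "restrict_space borel S"
  obtain s :: "'a \<Rightarrow> real" and p where s: "s \<in> borel_measurable borel" "\<And>y. s y \<in> {0..2}"
    and p: "continuous_on UNIV p" "\<And>t. p t \<in> S" and ps: "\<And>y. y \<in> S \<Longrightarrow> p (s y) = y"
    using compact_convex_real_parametrization[OF assms(1-3)] by metis
  have Qsets: "sets (Q n) = sets ?R" and Qprob: "prob_space (Q n)" for n
    using Q[of n] by (auto simp: prob_measures_def radon_measures_def)
  have Qspace: "space (Q n) = S" for n by (rule space_eq_if_sets_restrict_borel[OF Qsets])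
  have sQ [measurable]: "s \<in> borel_measurable (Q n)" for n
    using measurable_restrict_space1[OF s(1), of S] measurable_cong_sets[OF Qsets refl] by blast
  have pm [measurable]: "p \<in> measurable borel ?R"
    using p by (intro measurable_restrict_space2 borel_measurable_continuous_onI) auto
  define P where "P n = distr (Q n) borel s" for n
  have P: "real_distribution (P n)" for n
    unfolding P_def real_distribution_def real_distribution_axioms_def
    using prob_space.prob_space_distr[OF Qprob sQ] by simp
  \<comment> \<open>Tightness is formulated with intervals open on the left, so the left end must
    lie strictly below the range of \<open>s\<close>.\<close>
  have "measure (P n) {-1<..2} = 1" for n
  proof -
    have "s -` {-1<..2} \<inter> space (Q n) = space (Q n)"
      using s(2) by (auto simp: less_le_trans[of "-1" 0])
    then show ?thesis
      unfolding P_def by (simp add: measure_distr prob_space.prob_space[OF Qprob])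
  qed
  then have "tight P"
    unfolding tight_def using P by (intro conjI allI impI exI[of _ "-1"] exI[of _ 2]) auto
  then obtain r M where r: "strict_mono (r :: nat \<Rightarrow> nat)" and M: "real_distribution M"
    and conv: "weak_conv_m (P \<circ> id \<circ> r) M"
    using tight_imp_convergent_subsubsequence[of P id] by (auto simp: strict_mono_def)
  interpret M: real_distribution M by fact
  have pM [measurable]: "p \<in> measurable M ?R" using pm by simp
  define Q' where "Q' = distr M ?R p"
  show thesis
  proof
    show "strict_mono r" by fact
    show "Q' \<in> prob_measures S"
      unfolding Q'_def prob_measures_def radon_measures_def
      using M.prob_space_distr[OF pM] by (simp add: prob_space.finite_measure)
    fix f :: "'a \<Rightarrow> real" assume f: "continuous_on S f"
    have fR [measurable]: "f \<in> borel_measurable ?R"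
      using f by (rule borel_measurable_continuous_on_restrict)
    have "continuous_on UNIV (f \<circ> p)"
      using p f by (intro continuous_on_compose) (auto intro: continuous_on_subset)
    then have fp: "isCont (\<lambda>t. f (p t)) t" for t
      by (simp add: continuous_on_eq_continuous_at comp_def)
    have "bounded (f ` S)"
      using f assms(1) by (intro compact_imp_bounded compact_continuous_image)
    then obtain B where B: "\<And>y. y \<in> S \<Longrightarrow> norm (f y) \<le> B"
      by (auto simp: bounded_iff)
    have "(\<lambda>n. integral\<^sup>L ((P \<circ> id \<circ> r) n) (\<lambda>t. f (p t))) \<longlonglongrightarrow> integral\<^sup>L M (\<lambda>t. f (p t))"
      using P M conv fp B[OF p(2)]
      by (intro weak_conv_imp_integral_bdd_continuous_conv) (auto simp: comp_def)
    moreover have "integral\<^sup>L ((P \<circ> id \<circ> r) n) (\<lambda>t. f (p t)) = (\<integral>y. f y \<partial>Q (r n))" for n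
    proof -
      have "integral\<^sup>L ((P \<circ> id \<circ> r) n) (\<lambda>t. f (p t)) = (\<integral>y. f (p (s y)) \<partial>Q (r n))"
        unfolding P_def comp_def id_def by (subst integral_distr) auto
      also have "\<dots> = (\<integral>y. f y \<partial>Q (r n))"
        by (intro Bochner_Integration.integral_cong) (auto simp: Qspace ps)
      finally show ?thesis .
    qed
    moreover have "integral\<^sup>L M (\<lambda>t. f (p t)) = (\<integral>y. f y \<partial>Q')"
      unfolding Q'_def by (subst integral_distr) auto
    ultimately show "(\<lambda>n. \<integral>y. f y \<partial>Q (r n)) \<longlonglongrightarrow> (\<integral>y. f y \<partial>Q')" by simp
  qed
qed

section \<open>The objective and its minimizer\<close>

text \<open>The kernel is jointly measurable on the whole space; the identity maps into
  \<open>borel\<close> pull this back to the product of \<rho> and \<nu>, where measurability of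
  parameter integrals applies.\<close>

lemma borel_measurable_kernel_integral:
  assumes "sets \<rho> = sets (restrict_space borel S)" "sets \<nu> = sets (restrict_space borel S)"
    and "finite_measure \<nu>"
  shows "(\<lambda>x. \<integral>y. HK_kernel \<kappa> x y \<partial>\<nu>) \<in> borel_measurable \<rho>"
proof -
  interpret finite_measure \<nu> by fact
  have id: "(\<lambda>x. x) \<in> borel_measurable M" if "sets M = sets (restrict_space borel S)" for M :: "'a measure"
    using measurable_restrict_space1[OF measurable_ident, of borel S] measurable_cong_sets[OF that refl]
    by (auto simp: id_def)
  have [measurable]: "(\<lambda>x. x) \<in> borel_measurable \<rho>" "(\<lambda>x. x) \<in> borel_measurable \<nu>"
    by (intro id assms)+
  have "(\<lambda>z. (fst z, snd z)) \<in> measurable (\<rho> \<Otimes>\<^sub>M \<nu>) (borel \<Otimes>\<^sub>M borel)"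
    by measurable
  from measurable_compose[OF this borel_measurable_HK_kernel]
  have "case_prod (HK_kernel \<kappa>) \<in> borel_measurable (\<rho> \<Otimes>\<^sub>M \<nu>)"
    by (simp add: case_prod_unfold)
  then show ?thesis by (rule borel_measurable_lebesgue_integral)
qed

lemma kernel_integral_bounds:
  assumes "sets \<nu> = sets (restrict_space borel S)" "finite_measure \<nu>"
  shows "0 \<le> (\<integral>y. HK_kernel \<kappa> x y \<partial>\<nu>)" "(\<integral>y. HK_kernel \<kappa> x y \<partial>\<nu>) \<le> measure \<nu> S"
proof -
  interpret finite_measure \<nu> by fact
  have sp: "space \<nu> = S" by (rule space_eq_if_sets_restrict_borel[OF assms(1)])
  have "HK_kernel \<kappa> x \<in> borel_measurable \<nu>"
    by (rule borel_measurable_HK_kernel_restrict[OF assms(1)])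
  then have int: "integrable \<nu> (HK_kernel \<kappa> x)"
    by (intro integrable_const_bound[of _ 1]) (auto simp: HK_kernel_nonneg HK_kernel_le_1)
  have "(\<integral>y. HK_kernel \<kappa> x y \<partial>\<nu>) \<le> (\<integral>y. 1 \<partial>\<nu>)"
    using int by (intro integral_mono) (auto simp: HK_kernel_le_1)
  then show "(\<integral>y. HK_kernel \<kappa> x y \<partial>\<nu>) \<le> measure \<nu> S" by (simp add: sp)
  show "0 \<le> (\<integral>y. HK_kernel \<kappa> x y \<partial>\<nu>)" by (simp add: HK_kernel_nonneg)
qed

lemma HK_objective_eq:
  assumes "\<kappa> > 0" and \<rho>: "\<rho> \<in> prob_measures \<Omega>" and \<nu>: "\<nu> \<in> radon_measures \<Omega>"
  defines "J \<equiv> 1 + measure \<nu> \<Omega> - 2 * (\<integral>x. sqrt (\<integral>y. HK_kernel \<kappa> x y \<partial>\<nu>) \<partial>\<rho>)"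
  shows "HK_objective \<Omega> \<rho> \<kappa> \<nu> = ennreal J" "J \<ge> 0"
proof -
  let ?g = "\<lambda>x. sqrt (\<integral>y. HK_kernel \<kappa> x y \<partial>\<nu>)"
  have \<nu>': "sets \<nu> = sets (restrict_space borel \<Omega>)" "finite_measure \<nu>"
    using \<nu> by (auto simp: radon_measures_def)
  have \<rho>sets: "sets \<rho> = sets (restrict_space borel \<Omega>)" using \<rho> by (simp add: prob_measures_def radon_measures_def)
  then have \<rho>space: "space \<rho> = \<Omega>" by (rule space_eq_if_sets_restrict_borel)
  interpret \<rho>: prob_space \<rho> using \<rho> by (simp add: prob_measures_def)
  note bd = kernel_integral_bounds[OF \<nu>', of \<kappa>]
  have [measurable]: "?g \<in> borel_measurable \<rho>"
    using borel_measurable_kernel_integral[OF \<rho>sets \<nu>'] by measurable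
  have int: "integrable \<rho> ?g"
    using bd by (intro \<rho>.integrable_const_bound[of _ "sqrt (measure \<nu> \<Omega>)"]) auto
  \<comment> \<open>The square of \<open>?g x\<close> is at most the mass of \<nu>, so the
    expression dominates the square of \<open>1 - ?g x\<close>, and the cast to
    \<open>ennreal\<close> does not truncate.\<close>
  have nonneg: "0 \<le> 1 + measure \<nu> \<Omega> - 2 * ?g x" for x
  proof -
    have "0 \<le> (1 - ?g x)\<^sup>2" by simp
    then show ?thesis using bd[of x] by (simp add: power2_diff)
  qed
  have J: "J = (\<integral>x. 1 + measure \<nu> \<Omega> - 2 * ?g x \<partial>\<rho>)"
    using int by (simp add: J_def \<rho>.prob_space)
  show "J \<ge> 0" unfolding J using nonneg by simp
  have "HK_objective \<Omega> \<rho> \<kappa> \<nu> = (\<integral>\<^sup>+x. ennreal (1 + measure \<nu> \<Omega> - 2 * ?g x) \<partial>\<rho>)"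
    unfolding HK_objective_def using \<open>\<kappa> > 0\<close> \<nu>
    by (intro nn_integral_cong) (simp add: HK_sq_dirac \<rho>space)
  also have "\<dots> = ennreal J"
    unfolding J using int nonneg by (intro nn_integral_eq_integral) auto
  finally show "HK_objective \<Omega> \<rho> \<kappa> \<nu> = ennreal J" .
qed

section \<open>Maximizing over probability measures\<close>

text \<open>The direct method: \<open>G\<close> is bounded by 1, a maximizing sequence has a weakly
  convergent subsequence, and \<open>G\<close> is continuous along it.\<close>

lemma ex_prob_measure_maximizer:
  assumes "compact \<Omega>" "convex \<Omega>" "\<rho> \<in> prob_measures \<Omega>"
  obtains Q where "Q \<in> prob_measures \<Omega>"
    "\<And>Q'. Q' \<in> prob_measures \<Omega> \<Longrightarrow>
      (\<integral>x. sqrt (\<integral>y. HK_kernel \<kappa> x y \<partial>Q') \<partial>\<rho>) \<le> (\<integral>x. sqrt (\<integral>y. HK_kernel \<kappa> x y \<partial>Q) \<partial>\<rho>)"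
proof -
  define G where "G Q = (\<integral>x. sqrt (\<integral>y. HK_kernel \<kappa> x y \<partial>Q) \<partial>\<rho>)" for Q
  have \<rho>sets: "sets \<rho> = sets (restrict_space borel \<Omega>)"
    using assms(3) by (simp add: prob_measures_def radon_measures_def)
  then have \<rho>space: "space \<rho> = \<Omega>" by (rule space_eq_if_sets_restrict_borel)
  interpret \<rho>: prob_space \<rho> using assms(3) by (simp add: prob_measures_def)
  have "\<Omega> \<noteq> {}" using \<rho>.not_empty \<rho>space by simp
  have meas: "(\<lambda>x. sqrt (\<integral>y. HK_kernel \<kappa> x y \<partial>Q)) \<in> borel_measurable \<rho>"
    and root: "0 \<le> sqrt (\<integral>y. HK_kernel \<kappa> x y \<partial>Q)" "sqrt (\<integral>y. HK_kernel \<kappa> x y \<partial>Q) \<le> 1"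
    if Q: "Q \<in> prob_measures \<Omega>" for Q x
  proof -
    have Q': "sets Q = sets (restrict_space borel \<Omega>)" "finite_measure Q"
      using Q by (auto simp: prob_measures_def radon_measures_def)
    interpret Q: prob_space Q using Q by (simp add: prob_measures_def)
    show "(\<lambda>x. sqrt (\<integral>y. HK_kernel \<kappa> x y \<partial>Q)) \<in> borel_measurable \<rho>"
      using borel_measurable_kernel_integral[OF \<rho>sets Q'] by measurable
    show "0 \<le> sqrt (\<integral>y. HK_kernel \<kappa> x y \<partial>Q)" "sqrt (\<integral>y. HK_kernel \<kappa> x y \<partial>Q) \<le> 1"
      using kernel_integral_bounds(1)[OF Q', of \<kappa> x]
        order_trans[OF kernel_integral_bounds(2)[OF Q', of \<kappa> x] Q.prob_le_1] by auto
  qed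
  have "bdd_above (G ` prob_measures \<Omega>)"
  proof (rule bdd_aboveI2)
    fix Q assume Q: "Q \<in> prob_measures \<Omega>"
    have "integrable \<rho> (\<lambda>x. sqrt (\<integral>y. HK_kernel \<kappa> x y \<partial>Q))"
      using meas[OF Q] root[OF Q] by (intro \<rho>.integrable_const_bound[of _ 1]) auto
    then show "G Q \<le> 1"
      unfolding G_def using root[OF Q] by (intro \<rho>.integral_le_const) auto
  qed
  moreover define T where "T = (SUP Q\<in>prob_measures \<Omega>. G Q)"
  ultimately have T: "G Q \<le> T" if "Q \<in> prob_measures \<Omega>" for Q
    using that by (auto intro: cSUP_upper)
  have "\<exists>Q\<in>prob_measures \<Omega>. T - 1 / real (Suc n) < G Q" for n
    using less_cSUP_iff[OF _ \<open>bdd_above _\<close>, of "T - 1 / real (Suc n)"] assms(3)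
    by (auto simp: T_def)
  then obtain Q where Q: "\<And>n. Q n \<in> prob_measures \<Omega>" "\<And>n. T - 1 / real (Suc n) < G (Q n)"
    by metis
  show thesis
  proof (rule prob_measures_weakly_sequentially_compact[OF assms(1,2) \<open>\<Omega> \<noteq> {}\<close> Q(1)])
    fix r Q'
    assume r: "strict_mono r" and Q': "Q' \<in> prob_measures \<Omega>"
      and lim: "\<And>f :: 'a \<Rightarrow> real. continuous_on \<Omega> f \<Longrightarrow> (\<lambda>n. \<integral>y. f y \<partial>Q (r n)) \<longlonglongrightarrow> (\<integral>y. f y \<partial>Q')"
    have "(\<lambda>n. G (Q (r n))) \<longlonglongrightarrow> G Q'"
      unfolding G_def
    \<comment> \<open>For fixed \<open>x\<close> the kernel is continuous in \<open>y\<close>, so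
      weak convergence handles the inner integral; the roots are bounded by 1, which dominates the
      outer one.\<close>
    proof (rule integral_dominated_convergence[where w = "\<lambda>_. 1"])
      show "AE x in \<rho>. (\<lambda>n. sqrt (\<integral>y. HK_kernel \<kappa> x y \<partial>Q (r n))) \<longlonglongrightarrow> sqrt (\<integral>y. HK_kernel \<kappa> x y \<partial>Q')"
        by (intro AE_I2 tendsto_real_sqrt lim continuous_on_HK_kernel continuous_intros)
    qed (use meas Q(1) Q' root in auto)
    moreover have "(\<lambda>n. T - 1 / real (Suc (r n))) \<longlonglongrightarrow> T - 0"
      using LIMSEQ_subseq_LIMSEQ[OF LIMSEQ_inverse_real_of_nat r]
      by (intro tendsto_diff tendsto_const) (simp add: comp_def inverse_eq_divide)
    ultimately have "T - 0 \<le> G Q'"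
      using Q(2) by (intro LIMSEQ_le[of "\<lambda>n. T - 1 / real (Suc (r n))" _ "\<lambda>n. G (Q (r n))"]) (auto intro: less_imp_le)
    then have "G Q'' \<le> G Q'" if "Q'' \<in> prob_measures \<Omega>" for Q''
      using T[OF that] by simp
    then show thesis
      by (intro that[OF Q']) (simp only: G_def)
  qed
qed

section \<open>Scaling and the minimizer\<close>

text \<open>For non-negative \<open>f\<close> the integral is \<open>enn2real\<close> of
  \<open>nn_integral\<close>, and \<open>enn2real\<close> is multiplicative; if \<open>f\<close> has
  infinite integral, both sides are 0.\<close>

lemma integral_scale_measure:
  fixes f :: "'b \<Rightarrow> real"
  assumes "c \<ge> 0" "f \<in> borel_measurable M" "\<And>x. f x \<ge> 0"
  shows "(\<integral>x. f x \<partial>scale_measure (ennreal c) M) = c * (\<integral>x. f x \<partial>M)"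
proof -
  have "f \<in> borel_measurable (scale_measure (ennreal c) M)" using assms(2) by simp
  then show ?thesis
    using assms by (simp add: integral_eq_nn_integral nn_integral_scale_measure enn2real_mult)
qed

theorem corollary4p3:
  fixes \<Omega> :: "'a::euclidean_space set" and \<rho> :: "'a measure" and \<kappa> :: real
  assumes "compact \<Omega>" and "convex \<Omega>" and "interior \<Omega> \<noteq> {}"
    and "\<kappa> > 0"
    and "\<rho> \<in> prob_measures \<Omega>"
  shows "(\<exists>\<nu>\<in>radon_measures \<Omega>. \<forall>\<nu>'\<in>radon_measures \<Omega>.
            HK_objective \<Omega> \<rho> \<kappa> \<nu> \<le> HK_objective \<Omega> \<rho> \<kappa> \<nu>')
       \<and> (\<forall>\<nu>\<in>radon_measures \<Omega>.
            enn2ereal (HK_objective \<Omega> \<rho> \<kappa> \<nu>) =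
            ereal (1 + measure \<nu> \<Omega>
              - 2 * (\<integral>x. sqrt (\<integral>y. (Cos (norm (x - y) / \<kappa>))\<^sup>2 \<partial>\<nu>) \<partial>\<rho>)))"
proof (intro conjI ballI)
  note J = HK_objective_eq[OF \<open>\<kappa> > 0\<close> \<open>\<rho> \<in> prob_measures \<Omega>\<close>]
  show "enn2ereal (HK_objective \<Omega> \<rho> \<kappa> \<nu>) =
      ereal (1 + measure \<nu> \<Omega> - 2 * (\<integral>x. sqrt (\<integral>y. (Cos (norm (x - y) / \<kappa>))\<^sup>2 \<partial>\<nu>) \<partial>\<rho>))"
    if "\<nu> \<in> radon_measures \<Omega>" for \<nu>
    \<comment> \<open>Non-negativity of the formula is what lets \<open>enn2ereal\<close> recover it
      from its cast to \<open>ennreal\<close>.\<close>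
    using J[OF that] by (simp add: enn2ereal_ennreal HK_kernel_def)

  define G where "G \<nu> = (\<integral>x. sqrt (\<integral>y. HK_kernel \<kappa> x y \<partial>\<nu>) \<partial>\<rho>)" for \<nu>
  \<comment> \<open>\<open>G\<close> is homogeneous of degree 1/2, which separates the total mass of
    a measure from its shape.\<close>
  have scale_radon: "scale_measure (ennreal c) \<nu> \<in> radon_measures \<Omega>"
    and scale_G: "c \<ge> 0 \<Longrightarrow> G (scale_measure (ennreal c) \<nu>) = sqrt c * G \<nu>"
    if \<nu>: "\<nu> \<in> radon_measures \<Omega>" for c and \<nu> :: "'a measure"
  proof -
    have \<nu>': "sets \<nu> = sets (restrict_space borel \<Omega>)" "finite_measure \<nu>"
      using \<nu> by (auto simp: radon_measures_def)
    have "finite_measure (scale_measure (ennreal c) \<nu>)"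
      using finite_measure.emeasure_finite[OF \<nu>'(2)]
      by (intro finite_measureI) (auto simp: space_scale_measure ennreal_mult_eq_top_iff)
    then show "scale_measure (ennreal c) \<nu> \<in> radon_measures \<Omega>"
      using \<nu>' by (simp add: radon_measures_def)
    show "G (scale_measure (ennreal c) \<nu>) = sqrt c * G \<nu>" if "c \<ge> 0"
      unfolding G_def using that
      by (simp add: integral_scale_measure HK_kernel_nonneg borel_measurable_HK_kernel_restrict[OF \<nu>'(1)]
          real_sqrt_mult)
  qed
  obtain Q where Q: "Q \<in> prob_measures \<Omega>" "\<And>Q'. Q' \<in> prob_measures \<Omega> \<Longrightarrow> G Q' \<le> G Q"
    using ex_prob_measure_maximizer[OF \<open>compact \<Omega>\<close> \<open>convex \<Omega>\<close> \<open>\<rho> \<in> prob_measures \<Omega>\<close>, of \<kappa>]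
    unfolding G_def by metis
  have Qr: "Q \<in> radon_measures \<Omega>" using Q(1) by (simp add: prob_measures_def)
  have "space Q = \<Omega>"
    using Qr by (intro space_eq_if_sets_restrict_borel) (simp add: radon_measures_def)
  then have mQ: "measure Q \<Omega> = 1"
    using Q(1) prob_space.prob_space[of Q] by (simp add: prob_measures_def)
  have G_nonneg: "G \<nu> \<ge> 0" for \<nu>
    unfolding G_def by (simp add: HK_kernel_nonneg)
  \<comment> \<open>The mass \<open>m = (G Q)\<^sup>2\<close> minimizes
    \<open>1 + m - 2 * sqrt m * G Q\<close>.\<close>
  define \<nu>' where "\<nu>' = scale_measure (ennreal ((G Q)\<^sup>2)) Q"
  have \<nu>': "\<nu>' \<in> radon_measures \<Omega>" unfolding \<nu>'_def by (rule scale_radon[OF Qr])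
  have opt: "HK_objective \<Omega> \<rho> \<kappa> \<nu>' = ennreal (1 - (G Q)\<^sup>2)"
  proof -
    have "measure \<nu>' \<Omega> = (G Q)\<^sup>2" by (simp add: \<nu>'_def mQ)
    moreover have "G \<nu>' = (G Q)\<^sup>2"
      unfolding \<nu>'_def using G_nonneg[of Q] by (simp add: scale_G[OF Qr] power2_eq_square)
    ultimately show ?thesis using J(1)[OF \<nu>'] by (simp add: G_def)
  qed
  show "\<exists>\<nu>\<in>radon_measures \<Omega>. \<forall>\<nu>'\<in>radon_measures \<Omega>. HK_objective \<Omega> \<rho> \<kappa> \<nu> \<le> HK_objective \<Omega> \<rho> \<kappa> \<nu>'"
  proof (intro bexI[OF _ \<nu>'] ballI)
    fix \<nu> :: "'a measure" assume \<nu>: "\<nu> \<in> radon_measures \<Omega>"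
    have \<nu>m: "sets \<nu> = sets (restrict_space borel \<Omega>)" "finite_measure \<nu>"
      using \<nu> by (auto simp: radon_measures_def)
    interpret finite_measure \<nu> by fact
    have \<nu>space: "space \<nu> = \<Omega>"
      by (rule space_eq_if_sets_restrict_borel[OF \<nu>m(1)])
    define m where "m = measure \<nu> \<Omega>"
    have "m \<ge> 0" by (simp add: m_def)
    \<comment> \<open>Normalizing \<nu> makes it a competitor of \<open>Q\<close>; for
      \<open>m = 0\<close> no normalization exists, but then all kernel integrals vanish.\<close>
    have "G \<nu> \<le> sqrt m * G Q"
    proof (cases "m = 0")
      case True
      then have "(\<integral>y. HK_kernel \<kappa> x y \<partial>\<nu>) = 0" for x
        using kernel_integral_bounds[OF \<nu>m, of \<kappa> x] by (simp add: m_def)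
      then show ?thesis using True by (simp add: G_def)
    next
      case False
      then have "m > 0" using \<open>m \<ge> 0\<close> by simp
      define Q' where "Q' = scale_measure (ennreal (1 / m)) \<nu>"
      have Q'r: "Q' \<in> radon_measures \<Omega>" unfolding Q'_def by (rule scale_radon[OF \<nu>])
      have "emeasure Q' (space Q') = 1"
        using \<open>m > 0\<close> unfolding Q'_def
        by (simp add: space_scale_measure \<nu>space emeasure_eq_measure m_def[symmetric] ennreal_mult'[symmetric])
      then have "Q' \<in> prob_measures \<Omega>"
        using Q'r by (simp add: prob_measures_def prob_spaceI)
      moreover have "G Q' = G \<nu> / sqrt m"
        unfolding Q'_def using \<open>m > 0\<close> by (simp add: scale_G[OF \<nu>] real_sqrt_divide)
      ultimately have "G \<nu> / sqrt m \<le> G Q" using Q(2)[of Q'] by simp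
      then show ?thesis using \<open>m > 0\<close> by (simp add: field_simps)
    qed
    \<comment> \<open>Completing the square: \<open>1 + m - 2 * sqrt m * G Q\<close> exceeds
      \<open>1 - (G Q)\<^sup>2\<close> by exactly this term.\<close>
    moreover have "0 \<le> (sqrt m - G Q)\<^sup>2" by simp
    ultimately have "1 - (G Q)\<^sup>2 \<le> 1 + m - 2 * G \<nu>"
      using \<open>m \<ge> 0\<close> by (simp add: power2_diff algebra_simps)
    then show "HK_objective \<Omega> \<rho> \<kappa> \<nu>' \<le> HK_objective \<Omega> \<rho> \<kappa> \<nu>"
      unfolding opt J(1)[OF \<nu>] G_def m_def by (rule ennreal_leI)
  qed
qed

end
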